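(* Let $n\ge 2$ and let $B^n$ be the closed unit ball of $\mathbb{R}^n$ (with the Euclidean metric). Then every equilateral weight $f:B^n\to\mathbb{R}$ is constant.
   Context: Let $X$ be a metric space. A standard equilateral set in $X$ is a subset $A\subseteq X$ such that any two distinct members of $A$ are at distance exactly $1$; it is maximal in $X$ if it is not properly contained in another standard equilateral set in $X$. An equilateral weight on $X$ with weight $W\in\mathbb{R}$ is a function $f:X\to\mathbb{R}$ such that $\sum_{i\in I}f(x_i)=W$ for every maximal standard equilateral set $\{x_i:i\in I\}$ in $X$ (the $x_i$ being distinct). An equilateral weight on $X$ is an equilateral weight with some weight $W$. Here $X=B^n=\{x\in\mathbb{R}^n:\|x\|\le 1\}$ with the metric induced by the Euclidean norm. *)

theory Defs
  imports "HOL-Analysis.Analysis"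
begin

text \<open>A metric space is represented by a subset \<open>X\<close> of a type of class
  \<^class>\<open>metric_space\<close>, with the induced metric.\<close>

definition standard_equilateral :: "'a::metric_space set \<Rightarrow> bool" where
  "standard_equilateral A \<longleftrightarrow> (\<forall>x\<in>A. \<forall>y\<in>A. x \<noteq> y \<longrightarrow> dist x y = 1)"

definition maximal_standard_equilateral :: "'a::metric_space set \<Rightarrow> 'a set \<Rightarrow> bool" where
  "maximal_standard_equilateral X A \<longleftrightarrow>
     A \<subseteq> X \<and> standard_equilateral A \<and>
     \<not> (\<exists>B. B \<subseteq> X \<and> standard_equilateral B \<and> A \<subset> B)"

text \<open>The weight condition uses \<^const>\<open>has_sum\<close> because \<^const>\<open>sum\<close> would silently be \<open>0\<close> on an
  infinite equilateral set. For a finite \<open>A\<close>, in particular for every equilateral set in a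
  Euclidean space, it says \<open>sum f A = W\<close>. The values of \<open>f\<close> outside \<open>X\<close> are irrelevant.\<close>

definition equilateral_weight_with ::
    "'a::metric_space set \<Rightarrow> ('a \<Rightarrow> real) \<Rightarrow> real \<Rightarrow> bool" where
  "equilateral_weight_with X f W \<longleftrightarrow>
     (\<forall>A. maximal_standard_equilateral X A \<longrightarrow> (f has_sum W) A)"

definition equilateral_weight :: "'a::metric_space set \<Rightarrow> ('a \<Rightarrow> real) \<Rightarrow> bool" where
  "equilateral_weight X f \<longleftrightarrow> (\<exists>W. equilateral_weight_with X f W)"

end

theory Submission
  imports Defs
begin

text \<open>
  Let \<open>n\<close> be the dimension. An equilateral set in \<open>\<real>\<^sup>n\<close> has at most \<open>n + 1\<close> points, so the vertex set of
  every regular \<open>n\<close>-simplex of edge length 1 inside the ball is a maximal equilateral set, and the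
  values of \<open>f\<close> on it add up to \<open>W\<close>. Two such simplices that share vertices give linear relations
  between values of \<open>f\<close>; two kinds of such pairs suffice.

  \<^item> \<^emph>\<open>Two simplices with a common facet.\<close> The two opposite vertices lie at distance
    \<open>r = sqrt (2 + 2/n)\<close>, twice the height of a simplex. Conversely, any two points of the ball at
    distance \<open>r\<close> have such a facet between them inside the ball, once the facet is rotated so that
    one of its vertices points towards the origin; hence \<open>f\<close> agrees at them
    (\<open>eq_at_reflection_distance\<close>).
    Two points of the unit sphere at an angle of at most 90 degrees have a common point of the ball at distance
    \<open>r\<close> from both, so \<open>f\<close> takes a single value \<open>c\<close> on the sphere, and every point of norm at least
    \<open>r - 1\<close> is at distance \<open>r\<close> from a point of the sphere. So \<open>f = c\<close> on an annulus along the boundary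
    (\<open>eq_on_annulus\<close>).

  \<^item> \<^emph>\<open>Two simplices with a common vertex.\<close> Given \<open>x = t e\<close> with \<open>e\<close> a unit vector and \<open>0 \<le> t \<le> 1\<close>, put
    \<open>z = - (1 - t) e\<close>, the point opposite to \<open>x\<close> at distance 1 from it. Take one simplex with vertex
    \<open>z\<close> that is symmetric about the axis through \<open>e\<close>, and another one that contains the edge from \<open>z\<close>
    to \<open>x\<close>. All their vertices other than \<open>z\<close> and \<open>x\<close> have squared norm at least
    \<open>t\<^sup>2 + (2 - r) (1 - t)\<close>. If \<open>f = c\<close> at all points that far out, comparing the two sums gives
    \<open>f x = c\<close> (\<open>propagate_inwards\<close>).

  Since \<open>r < 2\<close>, the second step applies to points strictly closer to the origin than the region
  where \<open>f = c\<close> is already known. The squared norm drops by at least \<open>(2 - r)\<^sup>2\<close> each time, so finitely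
  many steps reach the origin.
\<close>

section \<open>Regular simplices of unit edge length\<close>

text \<open>The Gram matrix of a regular simplex, seen from a point at equal distance from its vertices. Two
  cases matter: \<open>\<alpha> = 1\<close>, \<open>\<beta> = 1/2\<close>, where that point is a further vertex, and
  \<open>\<alpha> = d / (2 (d + 1))\<close>, \<open>\<beta> = - \<alpha> / d\<close>, where it is the centre of a \<open>d\<close>-simplex. In both
  \<open>\<alpha> - \<beta> = 1/2\<close>, which means edge length 1.\<close>

definition equiangular :: "real \<Rightarrow> real \<Rightarrow> 'a::real_inner set \<Rightarrow> bool" where
  "equiangular \<alpha> \<beta> F \<longleftrightarrow> (\<forall>v\<in>F. v \<bullet> v = \<alpha>) \<and> (\<forall>v\<in>F. \<forall>w\<in>F. v \<noteq> w \<longrightarrow> v \<bullet> w = \<beta>)"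

lemma inner_sum_equiangular:
  assumes "equiangular \<alpha> \<beta> F" "finite F" "v \<in> F"
  shows "v \<bullet> \<Sum>F = \<alpha> + (real (card F) - 1) * \<beta>"
proof -
  have "v \<bullet> \<Sum>F = v \<bullet> v + (\<Sum>w\<in>F - {v}. v \<bullet> w)"
    using assms by (simp add: inner_sum_right flip: sum.remove)
  also have "(\<Sum>w\<in>F - {v}. v \<bullet> w) = (\<Sum>w\<in>F - {v}. \<beta>)"
    using assms by (intro sum.cong) (auto simp: equiangular_def)
  also have "\<dots> = (real (card F) - 1) * \<beta>"
  proof -
    have "card F \<ge> 1" using assms by (metis One_nat_def Suc_leI card_gt_0_iff empty_iff)
    then show ?thesis using assms by (simp add: of_nat_diff)
  qed
  finally show ?thesis using assms by (simp add: equiangular_def)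
qed

text \<open>By symmetry the new vector is sought as \<open>\<lambda> \<Sum>F + \<mu> g\<close> with \<open>g\<close> a unit vector orthogonal to \<open>F\<close>. The
  inner products with \<open>F\<close> fix \<open>\<lambda>\<close>, and the required norm fixes \<open>\<mu>\<^sup>2\<close>, which has the sign of
  \<open>\<alpha> + card F * \<beta>\<close>. If this quantity is zero then so is \<open>\<mu>\<close>, and the new vector lies in the span of \<open>F\<close>:
  this is how the last vertex of a centred simplex arises.\<close>

lemma extend_equiangular:
  fixes F :: "'a::euclidean_space set"
  assumes V: "subspace V" "F \<subseteq> V" and F: "finite F" "equiangular \<alpha> \<beta> F"
    and "\<beta> < \<alpha>" and nonneg: "0 \<le> \<alpha> + real (card F) * \<beta>"
    and room: "card F < dim V \<or> \<alpha> + real (card F) * \<beta> = 0"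
  obtains w where "w \<in> V" "w \<notin> F" "equiangular \<alpha> \<beta> (insert w F)"
proof -
  define k where "k = real (card F)"
  define D where "D = \<alpha> + (k - 1) * \<beta>"
  \<comment> \<open>\<open>D\<close> is the inner product of \<open>\<Sum>F\<close> with any member of \<open>F\<close>; \<open>M\<close> is \<open>\<mu>\<^sup>2\<close>.\<close>
  define M where "M = (\<alpha> - \<beta>) * (\<alpha> + k * \<beta>) / D"
  have D: "D > 0"
  proof (cases "\<beta> < 0")
    case True
    then show ?thesis using nonneg by (simp add: D_def k_def algebra_simps)
  next
    case False
    have "0 \<le> k * \<beta>" using False by (simp add: k_def)
    then show ?thesis using \<open>\<beta> < \<alpha>\<close> by (simp add: D_def algebra_simps)
  qed
  have M0: "M \<ge> 0" using D \<open>\<beta> < \<alpha>\<close> nonneg by (simp add: M_def k_def)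
  obtain g where g: "g \<in> V" "\<And>v. v \<in> F \<Longrightarrow> g \<bullet> v = 0" "M * (g \<bullet> g) = M"
  proof (cases "card F < dim V")
    case True
    have "dim F < dim V" using True dim_le_card'[OF F(1)] by simp
    then have "span F \<noteq> span V" by (metis dim_span less_irrefl)
    then have "span F \<subset> span V" using V(2) span_mono by blast
    from orthogonal_to_subspace_exists_gen[OF this]
    obtain x where x: "x \<noteq> 0" "x \<in> span V" "\<And>y. y \<in> span F \<Longrightarrow> orthogonal x y" by blast
    show thesis
    proof (rule that[of "x /\<^sub>R norm x"])
      show "x /\<^sub>R norm x \<in> V"
        using x(2) V(1) by (metis span_eq_iff subspace_scale)
      show "(x /\<^sub>R norm x) \<bullet> v = 0" if "v \<in> F" for v
        using x(3)[OF span_base[OF that]] by (simp add: orthogonal_def)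
      show "M * ((x /\<^sub>R norm x) \<bullet> (x /\<^sub>R norm x)) = M"
        using x(1) by (simp add: dot_square_norm power2_eq_square field_simps)
    qed
  next
    case False
    then have "M = 0" using room by (simp add: M_def k_def)
    then show thesis using that[of 0] V(1) by (simp add: subspace_0)
  qed
  define w where "w = (\<beta> / D) *\<^sub>R \<Sum>F + sqrt M *\<^sub>R g"
  have s: "v \<bullet> \<Sum>F = D" if "v \<in> F" for v
    using inner_sum_equiangular[OF F(2,1) that] by (simp add: D_def k_def)
  have ss: "\<Sum>F \<bullet> \<Sum>F = k * D"
    by (subst inner_sum_left) (simp add: s k_def)
  have gs: "g \<bullet> \<Sum>F = 0" by (simp add: inner_sum_right g(2))
  have wv: "w \<bullet> v = \<beta>" if "v \<in> F" for v
  proof -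
    have "v \<bullet> w = \<beta>"
      using s[OF that] g(2)[OF that] D by (simp add: w_def inner_add_right inner_commute[of v g])
    then show ?thesis by (simp add: inner_commute)
  qed
  have "w \<bullet> w = (\<beta> / D)^2 * (k * D) + M * (g \<bullet> g)"
    using gs ss M0 by (simp add: w_def inner_left_distrib inner_right_distrib inner_commute power2_eq_square)
  also have "\<dots> = (k * \<beta>^2 + (\<alpha> - \<beta>) * (\<alpha> + k * \<beta>)) / D"
    using D unfolding g(3) by (simp add: M_def power2_eq_square field_simps)
  also have "k * \<beta>^2 + (\<alpha> - \<beta>) * (\<alpha> + k * \<beta>) = \<alpha> * D"
    by (simp add: D_def power2_eq_square algebra_simps)
  finally have ww: "w \<bullet> w = \<alpha>" using D by simp
  show thesis
  proof
    show "w \<in> V" unfolding w_def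
      by (intro subspace_add subspace_scale subspace_sum V(1) g(1)) (use V(2) in auto)
    show "w \<notin> F" using wv ww \<open>\<beta> < \<alpha>\<close> by force
    show "equiangular \<alpha> \<beta> (insert w F)"
      using F(2) wv ww by (auto simp: equiangular_def inner_commute)
  qed
qed

lemma extend_equiangular_card:
  fixes F :: "'a::euclidean_space set"
  assumes "subspace V" "F \<subseteq> V" "finite F" "equiangular \<alpha> \<beta> F"
    and "\<beta> < \<alpha>" and "card F \<le> N"
    and "0 \<le> \<alpha> + (real N - 1) * \<beta>"
    and "N \<le> dim V \<or> N = Suc (dim V) \<and> \<alpha> + real (dim V) * \<beta> = 0"
  shows "\<exists>G. F \<subseteq> G \<and> G \<subseteq> V \<and> finite G \<and> card G = N \<and> equiangular \<alpha> \<beta> G"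
  using assms
proof (induction "N - card F" arbitrary: F)
  case 0
  then show ?case by (metis diff_is_0_eq le_antisym order_refl)
next
  case (Suc d)
  have lt: "card F < N" using Suc.hyps(2) by simp
  have "0 \<le> \<alpha> + real (card F) * \<beta>"
  proof (cases "\<beta> < 0")
    case True
    have "(real N - 1) * \<beta> \<le> real (card F) * \<beta>"
      using lt True by (intro mult_right_mono_neg) auto
    then show ?thesis using Suc.prems by linarith
  next
    case False
    then show ?thesis using Suc.prems(5) by (intro add_nonneg_nonneg) auto
  qed
  moreover have "card F < dim V \<or> \<alpha> + real (card F) * \<beta> = 0"
    using lt Suc.prems(8) by (auto simp: less_Suc_eq)
  ultimately obtain w where w: "w \<in> V" "w \<notin> F" "equiangular \<alpha> \<beta> (insert w F)"
    using extend_equiangular[OF Suc.prems(1-5)] by blast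
  have "d = N - card (insert w F)" "card (insert w F) \<le> N"
    using Suc w lt by auto
  from Suc.hyps(1)[OF this(1) Suc.prems(1) _ _ w(3) Suc.prems(5) this(2) Suc.prems(7,8)]
  show ?case using w Suc.prems by auto
qed

lemma dist_eq_1_iff_inner: "dist v w = 1 \<longleftrightarrow> (v - w) \<bullet> (v - w) = 1"
  by (simp add: dist_norm norm_eq_1)

lemma standard_equilateral_translate:
  assumes "equiangular \<alpha> \<beta> F" "\<alpha> - \<beta> = 1 / 2"
  shows "standard_equilateral ((+) p ` F)"
  unfolding standard_equilateral_def
proof clarsimp
  fix v w assume "v \<in> F" "w \<in> F" "v \<noteq> w"
  then have "(v - w) \<bullet> (v - w) = \<alpha> - 2 * \<beta> + \<alpha>"
    using assms(1) by (simp add: equiangular_def inner_diff_left inner_diff_right inner_commute)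
  then show "dist v w = 1" using assms(2) by (simp add: dist_eq_1_iff_inner)
qed

lemma standard_equilateral_insert:
  "standard_equilateral (insert x A) \<longleftrightarrow>
     standard_equilateral A \<and> (\<forall>y\<in>A. x \<noteq> y \<longrightarrow> dist x y = 1)"
  by (auto simp: standard_equilateral_def dist_commute)

text \<open>Seen from one of the points, the others are unit vectors with pairwise inner products \<open>1/2\<close>.
  Their Gram matrix is half the sum of the identity and the all-ones matrix, which is positive
  definite, so they are linearly independent.\<close>

lemma card_standard_equilateral_le:
  fixes A :: "'a::euclidean_space set"
  assumes "standard_equilateral A" "finite A"
  shows "card A \<le> Suc DIM('a)"
proof (cases "A = {}")
  case False
  then obtain b where b: "b \<in> A" by blast
  define U where "U = (\<lambda>a. a - b) ` (A - {b})"
  have finU: "finite U" using assms by (simp add: U_def)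
  have eq: "equiangular 1 (1/2) U"
  proof -
    have 1: "(a - b) \<bullet> (a - b) = 1" if "a \<in> A" "a \<noteq> b" for a
      using assms(1) b that by (auto simp: standard_equilateral_def simp flip: dist_eq_1_iff_inner)
    have "(a - b) \<bullet> (a' - b) = 1 / 2" if "a \<in> A" "a \<noteq> b" "a' \<in> A" "a' \<noteq> b" "a \<noteq> a'" for a a'
    proof -
      have "(a - a') \<bullet> (a - a') = 1"
        using assms(1) that by (auto simp: standard_equilateral_def simp flip: dist_eq_1_iff_inner)
      then show ?thesis using 1[OF that(1,2)] 1[OF that(3,4)]
        by (simp add: inner_diff_left inner_diff_right inner_commute)
    qed
    with 1 show ?thesis by (auto simp: equiangular_def U_def)
  qed
  have "independent U"
  proof (rule independent_if_scalars_zero[OF finU])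
    fix c x assume z: "(\<Sum>x\<in>U. c x *\<^sub>R x) = 0" and "x \<in> U"
    have c: "c v = - sum c U" if "v \<in> U" for v
    proof -
      have "0 = v \<bullet> (\<Sum>x\<in>U. c x *\<^sub>R x)" unfolding z by simp
      also have "\<dots> = c v * (v \<bullet> v) + (\<Sum>x\<in>U-{v}. c x * (v \<bullet> x))"
        by (subst sum.remove[OF finU that]) (simp add: inner_add_right inner_sum_right)
      also have "(\<Sum>x\<in>U-{v}. c x * (v \<bullet> x)) = (\<Sum>x\<in>U-{v}. c x * (1/2))"
        using eq that by (intro sum.cong) (auto simp: equiangular_def)
      also have "\<dots> = (sum c U - c v) / 2"
        using that finU sum_divide_distrib[of c "U - {v}" 2] by (simp add: sum_diff1)
      finally show ?thesis using eq that by (simp add: equiangular_def field_simps)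
    qed
    have "sum c U = (\<Sum>v\<in>U. - sum c U)" by (rule sum.cong[OF refl]) (rule c)
    also have "\<dots> = - (real (card U) * sum c U)" by simp
    finally have "(1 + real (card U)) * sum c U = 0" by (simp only: distrib_right mult_1_left)
    then have "sum c U = 0" by (simp add: add_nonneg_eq_0_iff)
    then show "c x = 0" using c[OF \<open>x \<in> U\<close>] by simp
  qed
  then have "card U \<le> DIM('a)" by (rule independent_bound[THEN conjunct2])
  moreover have "card U = card A - 1"
    using b assms by (simp add: U_def card_image)
  ultimately show ?thesis by simp
qed auto

lemma maximal_standard_equilateral_if_card:
  fixes A :: "'a::euclidean_space set"
  assumes "A \<subseteq> X" "standard_equilateral A" "finite A" "card A = Suc DIM('a)"
  shows "maximal_standard_equilateral X A"
  unfolding maximal_standard_equilateral_def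
proof (intro conjI notI assms)
  assume "\<exists>B\<subseteq>X. standard_equilateral B \<and> A \<subset> B"
  then obtain B b where B: "standard_equilateral B" "A \<subseteq> B" "b \<in> B" "b \<notin> A" by blast
  then have "standard_equilateral (insert b A)"
    by (auto simp: standard_equilateral_def subset_iff)
  from card_standard_equilateral_le[OF this] show False using B assms by simp
qed

section \<open>Points at reflection distance\<close>

locale ball_weight =
  fixes f :: "'a::euclidean_space \<Rightarrow> real" and W :: real
  assumes dim_ge_2: "DIM('a) \<ge> 2"
    and weight: "equilateral_weight_with (cball 0 1) f W"
begin

definition n :: real where "n = real DIM('a)"

text \<open>The distance between a vertex of the regular unit \<open>n\<close>-simplex and its mirror image in the opposite
  facet. Accordingly \<open>r / 2\<close> is the height of the simplex.\<close>

definition r :: real where "r = sqrt (2 + 2 / n)"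

lemma n_ge_2: "n \<ge> 2"
  using dim_ge_2 by (simp add: n_def)

lemma r_squared: "r\<^sup>2 = 2 + 2 / n"
  using n_ge_2 by (simp add: r_def)

lemma r_bounds: "1 < r" "r < 2"
proof -
  have "1 < 2 + 2 / n" using n_ge_2 by (simp add: add_pos_pos)
  then show "1 < r" unfolding r_def by (simp only: real_sqrt_gt_1_iff)
  have "2 / n \<le> 1" using n_ge_2 by simp
  then have "2 + 2 / n < 2\<^sup>2" by simp
  then show "r < 2" unfolding r_def by (intro real_less_lsqrt) auto
qed

lemma simplex_sum:
  assumes "A \<subseteq> cball 0 1" "standard_equilateral A" "finite A" "card A = Suc DIM('a)"
  shows "sum f A = W"
proof -
  have "(f has_sum W) A"
    using weight maximal_standard_equilateral_if_card[OF assms]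
    by (simp add: equilateral_weight_with_def)
  then show ?thesis using \<open>finite A\<close> has_sum_finite_iff by metis
qed

lemma unit_orthogonal_exists:
  obtains w :: 'a where "norm w = 1" "w \<bullet> u = 0"
proof -
  obtain x where "x \<noteq> 0" "orthogonal u x"
    using orthogonal_to_vector_exists[OF dim_ge_2] by blast
  then show thesis using that[of "x /\<^sub>R norm x"] by (simp add: orthogonal_def inner_commute)
qed

lemma unit_direction:
  fixes x :: 'a
  obtains u where "norm u = 1" "x = norm x *\<^sub>R u"
proof (cases "x = 0")
  case True
  then show thesis using that unit_orthogonal_exists[of 0] by (metis norm_zero scaleR_zero_left)
next
  case False
  then show thesis using that[of "x /\<^sub>R norm x"] by simp
qed

text \<open>The freedom to prescribe one vertex \<open>v0\<close> serves to rotate the facet about the axis \<open>u\<close>. The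
  squared circumradius \<open>(n - 1) / (2 n)\<close> is the one of a regular simplex of dimension \<open>n - 1\<close> and
  edge length 1.\<close>

lemma centred_facet:
  assumes "norm u = 1" "v0 \<bullet> u = 0" "v0 \<bullet> v0 = (n - 1) / (2 * n)"
  obtains F :: "'a set" where "finite F" "card F = DIM('a)" "v0 \<in> F" "\<And>v. v \<in> F \<Longrightarrow> v \<bullet> u = 0"
    "equiangular ((n - 1) / (2 * n)) (- 1 / (2 * n)) F"
proof -
  let ?V = "{v. u \<bullet> v = 0}"
  have "u \<noteq> 0" using assms by auto
  then have dV: "dim ?V = DIM('a) - 1" by (rule dim_hyperplane)
  have dV': "real (dim ?V) = n - 1" unfolding dV using dim_ge_2 by (simp add: n_def of_nat_diff)
  have n0: "n > 0" using n_ge_2 by simp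
  have "\<exists>G. {v0} \<subseteq> G \<and> G \<subseteq> ?V \<and> finite G \<and> card G = DIM('a) \<and>
     equiangular ((n - 1) / (2 * n)) (- 1 / (2 * n)) G"
  proof (rule extend_equiangular_card)
    show "subspace ?V" by (rule subspace_hyperplane)
    show "{v0} \<subseteq> ?V" using assms by (simp add: inner_commute)
    show "equiangular ((n - 1) / (2 * n)) (- 1 / (2 * n)) {v0}"
      using assms by (simp add: equiangular_def)
    show "- 1 / (2 * n) < (n - 1) / (2 * n)" using n0 by (intro divide_strict_right_mono) auto
    show "0 \<le> (n - 1) / (2 * n) + (real DIM('a) - 1) * (- 1 / (2 * n))"
      using n0 by (simp add: field_simps flip: n_def)
    show "DIM('a) \<le> dim ?V \<or> DIM('a) = Suc (dim ?V) \<and>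
        (n - 1) / (2 * n) + real (dim ?V) * (- 1 / (2 * n)) = 0"
      using n0 dim_ge_2 unfolding dV' by (simp add: dV field_simps)
    show "card {v0} \<le> DIM('a)" using dim_ge_2 by simp
  qed auto
  then show thesis using that by (auto simp: inner_commute subset_iff)
qed

text \<open>The facet is centred at \<open>m\<close>, and its apex may be on either side: \<open>h = r / 2\<close> or \<open>h = - r / 2\<close>. The
  height and the circumradius of the facet satisfy \<open>(r / 2)\<^sup>2 + (n - 1) / (2 n) = 1\<close>, so the apex has
  distance 1 from the vertices of the facet.\<close>

lemma apex_sum:
  assumes u: "norm u = 1" "\<And>v. v \<in> F \<Longrightarrow> v \<bullet> u = 0"
    and F: "finite F" "card F = DIM('a)" "equiangular ((n - 1) / (2 * n)) (- 1 / (2 * n)) F"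
    and h: "h\<^sup>2 = (r / 2)\<^sup>2"
    and ball: "norm (m + h *\<^sub>R u) \<le> 1" "\<And>v. v \<in> F \<Longrightarrow> norm (m + v) \<le> 1"
  shows "f (m + h *\<^sub>R u) + (\<Sum>v\<in>F. f (m + v)) = W"
proof -
  let ?x = "m + h *\<^sub>R u" and ?G = "(+) m ` F"
  have n0: "n > 0" using n_ge_2 by simp
  have d: "dist ?x (m + v) = 1" if "v \<in> F" for v
  proof -
    have "(h *\<^sub>R u - v) \<bullet> (h *\<^sub>R u - v) = h\<^sup>2 * (u \<bullet> u) + v \<bullet> v"
      using u(2)[OF that] by (simp add: inner_diff_left inner_diff_right inner_commute power2_eq_square)
    also have "\<dots> = (2 + 2 / n) / 4 + (n - 1) / (2 * n)"
      using u(1) F(3) that h r_squared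
      by (simp add: equiangular_def dot_square_norm power_divide)
    also have "\<dots> = 1" using n0 by (simp add: field_simps)
    finally show ?thesis by (simp add: dist_eq_1_iff_inner)
  qed
  have x: "?x \<notin> ?G" using d by fastforce
  have "sum f (insert ?x ?G) = W"
  proof (rule simplex_sum)
    show "insert ?x ?G \<subseteq> cball 0 1" using ball by auto
    have "standard_equilateral ?G"
      using F(3) by (rule standard_equilateral_translate) (use n0 in \<open>simp add: field_simps\<close>)
    then show "standard_equilateral (insert ?x ?G)"
      using d by (auto simp: standard_equilateral_insert)
    show "card (insert ?x ?G) = Suc DIM('a)" using x F by (simp add: card_image)
  qed (use F in auto)
  then show ?thesis using x F by (simp add: sum.reindex)
qed

text \<open>Let \<open>R\<close> be the circumradius of a facet. By the parallelogram law the midpoint \<open>m\<close> of \<open>x\<close> and \<open>y\<close>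
  has norm at most \<open>R\<close>. The common facet is centred at \<open>m\<close>, orthogonal to \<open>x - y\<close>, and has a vertex
  \<open>m + v0\<close> with \<open>v0\<close> opposite to the component \<open>p\<close> of \<open>m\<close> orthogonal to \<open>x - y\<close>. Then every vertex
  \<open>m + v\<close> satisfies \<open>m \<bullet> v \<le> 1 / (2 n)\<close>, and its squared norm is at most \<open>R\<^sup>2 + 1 / n + R\<^sup>2 = 1\<close>: the
  facet just fits into the ball, with equality when \<open>norm m = R\<close> and \<open>p = m\<close>.\<close>

lemma eq_at_reflection_distance:
  assumes "norm x \<le> 1" "norm y \<le> 1" "dist x y = r"
  shows "f x = f y"
proof -
  have n0: "n > 0" using n_ge_2 by simp
  define R where "R = sqrt ((n - 1) / (2 * n))"
  have R: "R\<^sup>2 = (n - 1) / (2 * n)" "R > 0" using n_ge_2 by (simp_all add: R_def)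
  define u where "u = (x - y) /\<^sub>R r"
  have u: "norm u = 1" using assms(3) r_bounds by (simp add: u_def dist_norm)
  define m where "m = (x + y) /\<^sub>R 2"
  have x: "x = m + (r / 2) *\<^sub>R u" and y: "y = m + (- (r / 2)) *\<^sub>R u"
    using r_bounds by (simp_all add: u_def m_def algebra_simps flip: scaleR_add_left)
  have mR: "m \<bullet> m \<le> R\<^sup>2"
  proof -
    have "4 * (m \<bullet> m) = 2 * (x \<bullet> x) + 2 * (y \<bullet> y) - (x - y) \<bullet> (x - y)"
      by (simp add: m_def inner_add_left inner_add_right inner_diff_left inner_diff_right inner_commute algebra_simps)
    also have "\<dots> \<le> 2 * 1 + 2 * 1 - r\<^sup>2"
      using assms by (intro diff_mono add_mono mult_left_mono)
        (auto simp: dot_square_norm dist_norm power_le_one)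
    finally show ?thesis using n0 by (simp add: R r_squared field_simps)
  qed
  define p where "p = m - (m \<bullet> u) *\<^sub>R u"
  have uu: "u \<bullet> u = 1" using u by (simp add: dot_square_norm)
  have pu: "p \<bullet> u = 0" by (simp add: p_def inner_diff_left uu)
  have "p \<bullet> p = m \<bullet> m - (m \<bullet> u)\<^sup>2"
    by (simp add: p_def inner_diff_left inner_diff_right uu inner_commute power2_eq_square)
  then have "p \<bullet> p \<le> R\<^sup>2" using mR by (smt (verit) zero_le_power2)
  then have pR: "norm p \<le> R" using R(2) by (simp add: dot_square_norm power2_le_iff_abs_le)
  obtain v0 l where v0: "v0 \<bullet> u = 0" "v0 \<bullet> v0 = R\<^sup>2" "p = - l *\<^sub>R v0" "0 \<le> l" "l \<le> 1"
  proof (cases "p = 0")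
    case True
    obtain w where w: "norm w = 1" "w \<bullet> u = 0" using unit_orthogonal_exists .
    show thesis
      by (rule that[of "R *\<^sub>R w" 0]) (use w True in \<open>auto simp: dot_square_norm power_mult_distrib\<close>)
  next
    case False
    show thesis
      by (rule that[of "- (R / norm p) *\<^sub>R p" "norm p / R"])
        (use False R(2) pR pu in \<open>auto simp: dot_square_norm power_divide\<close>)
  qed
  obtain F where F: "finite F" "card F = DIM('a)" "v0 \<in> F" "\<And>v. v \<in> F \<Longrightarrow> v \<bullet> u = 0"
    "equiangular ((n - 1) / (2 * n)) (- 1 / (2 * n)) F"
    by (rule centred_facet[OF u v0(1) v0(2)[unfolded R(1)]]) blast
  have ball: "norm (m + v) \<le> 1" if v: "v \<in> F" for v
  proof -
    have vv: "v \<bullet> v = R\<^sup>2" using F(5) v by (simp add: equiangular_def R)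
    have "p \<bullet> v \<le> 1 / (2 * n)"
    proof (cases "v = v0")
      case True
      have "p \<bullet> v = - (l * R\<^sup>2)" using v0 True by simp
      also have "\<dots> \<le> 0" using v0 by simp
      also have "\<dots> \<le> 1 / (2 * n)" using n0 by simp
      finally show ?thesis .
    next
      case False
      then have "p \<bullet> v = l * (1 / (2 * n))" using v0 F(3,5) v by (simp add: equiangular_def)
      also have "\<dots> \<le> 1 * (1 / (2 * n))" using v0 n0 by (intro mult_right_mono) auto
      finally show ?thesis by simp
    qed
    moreover have "p \<bullet> v = m \<bullet> v" using F(4)[OF v]
      by (simp add: p_def inner_diff_left inner_commute[of u v])
    moreover have "(m + v) \<bullet> (m + v) = m \<bullet> m + 2 * (m \<bullet> v) + v \<bullet> v"
      by (simp add: inner_add_left inner_add_right inner_commute)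
    ultimately have "(m + v) \<bullet> (m + v) \<le> R\<^sup>2 + 2 * (1 / (2 * n)) + R\<^sup>2"
      using mR vv by linarith
    also have "\<dots> = 1" using n0 by (simp add: R field_simps)
    finally show ?thesis by (simp add: dot_square_norm abs_square_le_1)
  qed
  have "f x + (\<Sum>v\<in>F. f (m + v)) = W" unfolding x
    by (rule apex_sum[OF u F(4,1,2,5)]) (use assms x ball in auto)
  moreover have "f y + (\<Sum>v\<in>F. f (m + v)) = W" unfolding y
    by (rule apex_sum[OF u F(4,1,2,5)]) (use assms y ball in auto)
  ultimately show ?thesis by simp
qed

section \<open>The weight is constant near the boundary\<close>

text \<open>A point \<open>y = - s e\<close> on the bisector \<open>e\<close> of \<open>x\<close> and \<open>x'\<close>, on the far side of the origin, is
  equidistant from both. With \<open>k = x \<bullet> e\<close> the distance is \<open>r\<close> if \<open>(s + k)\<^sup>2 = k\<^sup>2 + r\<^sup>2 - 1\<close>. The solution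
  has \<open>s \<le> 1\<close> as soon as \<open>k \<ge> 1 / n\<close>, which holds if the angle between \<open>x\<close> and \<open>x'\<close> is at most 90 degrees.\<close>

lemma eq_on_sphere_if_inner_nonneg:
  assumes x: "norm x = 1" "norm x' = 1" and nonneg: "x \<bullet> x' \<ge> 0"
  shows "f x = f x'"
proof -
  have xx: "x \<bullet> x = 1" "x' \<bullet> x' = 1" using x by (simp_all add: norm_eq_1)
  define k where "k = norm (x + x') / 2"
  have k2: "k\<^sup>2 = (1 + x \<bullet> x') / 2"
    by (simp add: k_def power_divide xx inner_add_left inner_add_right inner_commute
        flip: dot_square_norm)
  have "(1 / 2)\<^sup>2 \<le> k\<^sup>2" unfolding k2 using nonneg by (simp add: power2_eq_square)
  then have k: "1 / 2 \<le> k" by (rule power2_le_imp_le) (simp add: k_def)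
  define e where "e = (1 / (2 * k)) *\<^sub>R (x + x')"
  have "norm (x + x') > 0" using k unfolding k_def by linarith
  then have ne: "norm e = 1" by (simp add: e_def k_def)
  have xe: "x \<bullet> e = k" "x' \<bullet> e = k"
    using k k2 xx by (simp_all add: e_def inner_add_right inner_commute power2_eq_square field_simps)
  define s where "s = sqrt (k\<^sup>2 + r\<^sup>2 - 1) - k"
  have "1 \<le> r\<^sup>2" using r_bounds by (simp add: one_le_power)
  then have s0: "0 \<le> s" using k unfolding s_def by (simp add: real_le_rsqrt)
  have "0 \<le> k\<^sup>2 + r\<^sup>2 - 1" using \<open>1 \<le> r\<^sup>2\<close> zero_le_power2[of k] by linarith
  then have sk: "(s + k)\<^sup>2 = k\<^sup>2 + r\<^sup>2 - 1" by (simp add: s_def)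
  have "r\<^sup>2 \<le> 2 + 2 * k"
  proof -
    have "2 / n \<le> 1" using n_ge_2 by simp
    then show ?thesis using k unfolding r_squared by linarith
  qed
  then have "(s + k)\<^sup>2 \<le> (1 + k)\<^sup>2" unfolding sk by (simp add: power2_eq_square algebra_simps)
  then have s1: "s \<le> 1" using power2_le_imp_le k by fastforce
  define y where "y = - s *\<^sub>R e"
  have ny: "norm y \<le> 1" using ne s0 s1 by (simp add: y_def)
  have d: "dist z y = r" if "z \<bullet> z = 1" "z \<bullet> e = k" for z
  proof -
    have "(dist z y)\<^sup>2 = 1 + 2 * s * k + s\<^sup>2"
      using that ne[unfolded norm_eq_1] unfolding dist_norm dot_square_norm[symmetric]
      by (simp add: y_def inner_add_left inner_add_right inner_commute power2_eq_square)
    also have "\<dots> = r\<^sup>2" using sk by (simp add: power2_eq_square algebra_simps)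
    finally show ?thesis using r_bounds by (simp add: power2_eq_iff_nonneg)
  qed
  show ?thesis
    using eq_at_reflection_distance[OF _ ny d[OF xx(1) xe(1)]]
      eq_at_reflection_distance[OF _ ny d[OF xx(2) xe(2)]] x by simp
qed

text \<open>Any two points of the sphere are linked by a third one, orthogonal to the first and
  with nonnegative inner product with the second.\<close>

lemma eq_on_sphere:
  assumes "norm x = 1" "norm x' = 1"
  shows "f x = f x'"
proof -
  obtain w where w: "norm w = 1" "w \<bullet> x = 0" using unit_orthogonal_exists .
  define v where "v = (if w \<bullet> x' \<ge> 0 then w else - w)"
  have "norm v = 1" "x \<bullet> v \<ge> 0" "v \<bullet> x' \<ge> 0" using w by (auto simp: v_def inner_commute)
  then show ?thesis using eq_on_sphere_if_inner_nonneg[of x v] eq_on_sphere_if_inner_nonneg[of v x'] assms by simp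
qed

text \<open>The distance from \<open>y\<close> to the points of the sphere takes every value between \<open>1 - norm y\<close> and
  \<open>1 + norm y\<close>, and \<open>r\<close> lies in this range.\<close>

lemma eq_on_annulus:
  assumes "norm x = 1" "r - 1 \<le> norm y" "norm y \<le> 1"
  shows "f y = f x"
proof -
  obtain e where e: "norm e = 1" "y = norm y *\<^sub>R e" using unit_direction .
  obtain w where w: "norm w = 1" "w \<bullet> e = 0" using unit_orthogonal_exists .
  define s where "s = norm y"
  have s: "0 < s" "r \<le> 1 + s" "s \<le> 1" using assms r_bounds unfolding s_def by linarith+
  \<comment> \<open>By the law of cosines, \<open>c\<close> is the cosine of the angle between \<open>y\<close> and the wanted point of the sphere.\<close>
  define c where "c = (1 + s\<^sup>2 - r\<^sup>2) / (2 * s)"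
  have c1: "- 1 \<le> c"
  proof -
    have "r\<^sup>2 \<le> (1 + s)\<^sup>2" using s r_bounds by (intro power_mono) auto
    then show ?thesis using s by (simp add: c_def field_simps power2_eq_square)
  qed
  have c2: "c \<le> 1"
  proof -
    have "(1 - s)\<^sup>2 \<le> 1" using s by (simp add: power_le_one)
    also have "1 \<le> r\<^sup>2" using r_bounds by (simp add: one_le_power)
    finally show ?thesis using s by (simp add: c_def field_simps power2_eq_square)
  qed
  have c3: "c\<^sup>2 \<le> 1" using c1 c2 by (simp add: abs_square_le_1)
  define z where "z = c *\<^sub>R e + sqrt (1 - c\<^sup>2) *\<^sub>R w"
  have ee: "e \<bullet> e = 1" "w \<bullet> w = 1" using e(1) w(1) by (simp_all add: norm_eq_1)
  have zz: "z \<bullet> z = 1" using c3 w(2) ee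
    by (simp add: z_def inner_add_left inner_add_right inner_commute power2_eq_square)
  have ze: "z \<bullet> e = c" using w(2) ee by (simp add: z_def inner_add_left)
  have y: "y = s *\<^sub>R e" unfolding s_def by (rule e(2))
  have "(dist z y)\<^sup>2 = 1 - 2 * s * c + s\<^sup>2"
    using zz ze ee unfolding dist_norm dot_square_norm[symmetric] y
    by (simp add: inner_diff_left inner_diff_right inner_commute power2_eq_square)
  also have "\<dots> = r\<^sup>2" using s by (simp add: c_def)
  finally have d: "dist z y = r" using r_bounds by (simp add: power2_eq_iff_nonneg)
  have nz: "norm z = 1" using zz by (simp add: norm_eq_1)
  have "f z = f y" using nz assms(3) d by (intro eq_at_reflection_distance) auto
  moreover have "f z = f x" using nz assms(1) by (rule eq_on_sphere)
  ultimately show ?thesis by simp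
qed

section \<open>From the boundary to the centre\<close>

text \<open>Write \<open>s = 1 - norm x\<close>, and let \<open>z\<close> be the point of norm \<open>s\<close> opposite to \<open>x\<close>. In the simplex with
  vertex \<open>z\<close> and axis through the origin, the other vertices have squared norm \<open>1 - r s + s\<^sup>2\<close>, which is
  the bound in the hypothesis written in terms of \<open>s\<close>. In a simplex with the edge from \<open>z\<close> to \<open>x\<close>, the
  other vertices have squared norm \<open>1 - s + s\<^sup>2\<close>, which is at least as large because \<open>r \<ge> 1\<close>. So
  \<open>f z + n c = W = f z + f x + (n - 1) c\<close>.\<close>

lemma propagate_inwards:
  assumes outer: "\<And>y. norm y \<le> 1 \<Longrightarrow> a \<le> (norm y)\<^sup>2 \<Longrightarrow> f y = c"
    and x: "norm x \<le> 1" "a \<le> (norm x)\<^sup>2 + (2 - r) * (1 - norm x)"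
  shows "f x = c"
proof -
  obtain e where e: "norm e = 1" "x = norm x *\<^sub>R e" using unit_direction .
  have ee: "e \<bullet> e = 1" using e(1) by (simp add: norm_eq_1)
  define s where "s = 1 - norm x"
  have s: "0 \<le> s" "s \<le> 1" using x(1) by (simp_all add: s_def)
  define z where "z = - s *\<^sub>R e"
  have nz: "norm z \<le> 1" using s e(1) by (simp add: z_def)
  have n0: "n > 0" using n_ge_2 by simp
  have a: "a \<le> 1 - r * s + s\<^sup>2"
    using x(2) by (simp add: s_def power2_eq_square algebra_simps)
  have in1: "norm y \<le> 1" if "(norm y)\<^sup>2 \<le> 1" for y :: 'a
    using that by (simp add: abs_square_le_1)

  \<comment> \<open>The simplex that is symmetric about the axis.\<close>
  have "f z + n * c = W"
  proof -
    obtain w where w: "norm w = 1" "w \<bullet> e = 0" using unit_orthogonal_exists .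
    define v0 where "v0 = sqrt ((n - 1) / (2 * n)) *\<^sub>R w"
    have v0: "v0 \<bullet> e = 0" "v0 \<bullet> v0 = (n - 1) / (2 * n)"
      using w n_ge_2 by (simp_all add: v0_def dot_square_norm)
    obtain F where F: "finite F" "card F = DIM('a)" "\<And>v. v \<in> F \<Longrightarrow> v \<bullet> e = 0"
      "equiangular ((n - 1) / (2 * n)) (- 1 / (2 * n)) F"
      by (rule centred_facet[OF e(1) v0]) blast
    define m where "m = (r / 2 - s) *\<^sub>R e"
    have z: "z = m + (- (r / 2)) *\<^sub>R e"
      by (simp add: z_def m_def algebra_simps)
    have nF: "(norm (m + v))\<^sup>2 = 1 - r * s + s\<^sup>2" if v: "v \<in> F" for v
    proof -
      have "(norm (m + v))\<^sup>2 = (r / 2 - s)\<^sup>2 + (n - 1) / (2 * n)"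
        using ee F(3)[OF v] F(4) v unfolding dot_square_norm[symmetric]
        by (simp add: m_def inner_add_left inner_add_right inner_commute power2_eq_square equiangular_def)
      also have "\<dots> = s\<^sup>2 - r * s + r\<^sup>2 / 4 + (n - 1) / (2 * n)"
        by (simp add: power2_eq_square algebra_simps)
      also have "\<dots> = 1 - r * s + s\<^sup>2" unfolding r_squared using n0 by (simp add: field_simps)
      finally show ?thesis .
    qed
    have "s * s \<le> r * s" using s r_bounds by (intro mult_right_mono) auto
    then have nF1: "norm (m + v) \<le> 1" if "v \<in> F" for v
      using nF[OF that] by (intro in1) (simp add: power2_eq_square)
    have "f z + (\<Sum>v\<in>F. f (m + v)) = W" unfolding z
      by (rule apex_sum[OF e(1) F(3,1,2,4)]) (use nz z nF1 in auto)
    also have "(\<Sum>v\<in>F. f (m + v)) = (\<Sum>v\<in>F. c)"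
      using nF nF1 a by (intro sum.cong outer) auto
    finally show ?thesis using F(2) by (simp add: n_def)
  qed

  \<comment> \<open>The simplex with the edge from \<open>z\<close> to \<open>x = z + e\<close>; \<open>G\<close> consists of the edge vectors at \<open>z\<close>.\<close>
  moreover have "f z + f x + (n - 1) * c = W"
  proof -
    have "\<exists>G. {e} \<subseteq> G \<and> G \<subseteq> UNIV \<and> finite G \<and> card G = DIM('a) \<and> equiangular 1 (1 / 2) G"
      using ee dim_ge_2 by (intro extend_equiangular_card) (auto simp: equiangular_def)
    then obtain G where G: "e \<in> G" "finite G" "card G = DIM('a)" "equiangular 1 (1 / 2) G"
      by blast
    have gg: "g \<bullet> g = 1" if "g \<in> G" for g using G(4) that by (simp add: equiangular_def)
    have d: "dist z (z + g) = 1" if "g \<in> G" for g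
      using gg[OF that] by (simp add: dist_norm norm_eq_1)
    have zG: "z \<notin> (+) z ` G" using d by fastforce
    have ze: "z + e = x" by (subst e(2)) (simp add: z_def s_def algebra_simps)
    have nG: "(norm (z + g))\<^sup>2 = 1 - s + s\<^sup>2" if "g \<in> G" "g \<noteq> e" for g
    proof -
      have "g \<bullet> e = 1 / 2" using G(1,4) that by (simp add: equiangular_def)
      then show ?thesis using ee gg[OF that(1)] unfolding dot_square_norm[symmetric]
        by (simp add: z_def inner_diff_left inner_diff_right inner_commute power2_eq_square)
    qed
    have "s * s \<le> 1 * s" using s by (intro mult_right_mono) auto
    then have nG1: "norm (z + g) \<le> 1" if "g \<in> G" "g \<noteq> e" for g
      using nG[OF that] by (intro in1) (simp add: power2_eq_square)
    have "1 * s \<le> r * s" using s r_bounds by (intro mult_right_mono) auto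
    then have aG: "a \<le> (norm (z + g))\<^sup>2" if "g \<in> G" "g \<noteq> e" for g
      using nG[OF that] a by simp
    have "sum f (insert z ((+) z ` G)) = W"
    proof (rule simplex_sum)
      show "insert z ((+) z ` G) \<subseteq> cball 0 1"
        using nz nG1 x(1) ze by force
      show "standard_equilateral (insert z ((+) z ` G))"
        using d standard_equilateral_translate[OF G(4)] by (auto simp: standard_equilateral_insert)
      show "card (insert z ((+) z ` G)) = Suc DIM('a)"
        using zG G by (simp add: card_image)
    qed (use G in auto)
    then have "f z + (\<Sum>g\<in>G. f (z + g)) = W" using zG G by (simp add: sum.reindex)
    also have "(\<Sum>g\<in>G. f (z + g)) = f x + (\<Sum>g\<in>G-{e}. f (z + g))"
      using G ze by (simp add: sum.remove)
    also have "(\<Sum>g\<in>G-{e}. f (z + g)) = (\<Sum>g\<in>G-{e}. c)"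
      using nG1 aG by (intro sum.cong outer) auto
    also have "\<dots> = (n - 1) * c"
      using G dim_ge_2 by (simp add: n_def of_nat_diff)
    finally show ?thesis by simp
  qed
  ultimately show ?thesis by (simp add: algebra_simps)
qed

text \<open>At points of norm less than \<open>r - 1\<close> the gain \<open>(2 - r) (1 - norm x)\<close> of an inward step exceeds
  \<open>(2 - r)\<^sup>2\<close>, so \<open>k\<close> steps extend the annulus down to squared norm \<open>(r - 1)\<^sup>2 - k (2 - r)\<^sup>2\<close>.\<close>

lemma constant_on_ball: "f constant_on cball 0 1"
proof -
  obtain e :: 'a where e: "norm e = 1" using unit_orthogonal_exists[of 0] by blast
  define \<delta> where "\<delta> = (2 - r)\<^sup>2"
  have \<delta>: "\<delta> > 0" using r_bounds by (simp add: \<delta>_def)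
  have layer: "f x = f e" if "norm x \<le> 1" "(r - 1)\<^sup>2 - real k * \<delta> \<le> (norm x)\<^sup>2" for k x
    using that
  proof (induction k arbitrary: x)
    case 0
    then have "r - 1 \<le> norm x" using power2_le_imp_le[of "r - 1" "norm x"] by simp
    then show ?case using eq_on_annulus e 0 by blast
  next
    case (Suc k)
    show ?case
    proof (cases "r - 1 \<le> norm x")
      case True
      then show ?thesis using eq_on_annulus e Suc.prems by blast
    next
      case False
      then have "\<delta> \<le> (2 - r) * (1 - norm x)"
        using r_bounds unfolding \<delta>_def power2_eq_square by (intro mult_left_mono) auto
      then have "(r - 1)\<^sup>2 - real k * \<delta> \<le> (norm x)\<^sup>2 + (2 - r) * (1 - norm x)"
        using Suc.prems(2) by (simp add: algebra_simps)
      from propagate_inwards[OF Suc.IH Suc.prems(1) this] show ?thesis .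
    qed
  qed
  obtain k where "(r - 1)\<^sup>2 < real k * \<delta>" using reals_Archimedean3[OF \<delta>] by blast
  then have "f x = f e" if "norm x \<le> 1" for x
    using layer[OF that, of k] by (smt (verit) zero_le_power2)
  then show ?thesis unfolding constant_on_def by auto
qed

end

theorem theorem3p7:
  fixes f :: "real ^ 'n \<Rightarrow> real"
  assumes "CARD('n) \<ge> 2"
    and "equilateral_weight (cball 0 1) f"
  shows "f constant_on cball 0 1"
proof -
  from assms(2) obtain W where "equilateral_weight_with (cball 0 1) f W"
    unfolding equilateral_weight_def by blast
  then interpret ball_weight f W
    using assms(1) by unfold_locales auto
  show ?thesis by (rule constant_on_ball)
qed

end
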